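(* Let $I\subseteq\mathbb R$ be an interval. If $Z:I^2\to T^{(n)}(V)$ is an almost-multiplicative path of degree $n$ (of roughness $p$) and finite $p$-variation, $n\ge\lfloor p\rfloor$, then there exists a unique multiplicative path $\widetilde Z$ in $T^{(\lfloor p\rfloor)}(V)$ with finite $p$-variation such that $$\|Z^{\bar\mu}-\widetilde Z^{\bar\mu}\|_{z}\le K$$ for some $z>1$ and all multi-indices $\bar\mu$ such that $|\bar\mu|\le\lfloor p\rfloor$, where $K$ is a positive constant.
   Context: $V$ is a finite-dimensional vector space, $n$ is an integer, $T^{(n)}(V)=\bigoplus_{k=0}^nV^{\otimes k}$ with $V^{\otimes0}=\mathbb R$. In a fixed basis of $V$, a multi-index $\bar\mu=(\mu_1,\dots,\mu_k)$ has degree $|\bar\mu|=k$ and $Z^{\bar\mu}$ denotes the corresponding component in $V^{\otimes k}$; $\emptyset$ is the empty multi-index, of degree $0$; $\bar\nu\bar\kappa$ denotes concatenation. For a process $R$ on $I^2$, $\|R\|_a:=\sup_{s\ne t\in I}|R_{st}|/|t-s|^a$, and $(NR)_{sut}:=R_{st}-R_{ut}-R_{su}$. The product of two processes is $(AB)_{sut}:=A_{su}B_{ut}$. $\Omega\mathcal C_2^z(I)$ is the space of finite sums of bounded continuous functions $A_i$ on $I^3$, zero when the three arguments coincide, with $\sup|A_{i,sut}|/(|u-s|^{\rho_i}|t-u|^{z-\rho_i})<\infty$ for some $0<\rho_i<z$. A tensor-valued path $Z:I^2\to T^{(n)}(V)$ (a path of degree $n$) is of finite $p$-variation if, for some constant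 $K$, $\|Z^{\bar\mu}\|_{|\bar\mu|/p}\le K^{|\bar\mu|}$ for all $\bar\mu$ with $|\bar\mu|\le n$. A path $Z$ of degree $n$ and finite $p$-variation is almost multiplicative (of roughness $p$) if $Z^\emptyset\equiv1$, $n\ge\lfloor p\rfloor$ and $$NZ^{\bar\mu}=\sum_{\bar\nu\bar\kappa=\bar\mu}Z^{\bar\nu}Z^{\bar\kappa}+R^{\bar\mu}$$ (for non-empty $\bar\mu$) with $R^{\bar\mu}\in\Omega\mathcal C_2^z(I)$ for some $z>1$ uniformly for all $\bar\mu$; by convention the sum does not include the terms where either $\bar\nu=\emptyset$ or $\bar\kappa=\emptyset$. A path $Z$ is multiplicative if $Z^\emptyset\equiv1$ and $NZ^{\bar\mu}=\sum_{\bar\nu\bar\kappa=\bar\mu}Z^{\bar\nu}Z^{\bar\kappa}$ (non-empty $\bar\mu$, same summation convention).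
   Formalization: The interval I is assumed bounded: on an unbounded I the claim fails, e.g. I = ℝ, V = ℝ, p = 3/2, n = 1, Z_st = max(-1, min(1, t-s)), where closeness forces Z̃_st = t-s, which has infinite p-variation norm. *)

theory Defs
  imports "HOL-Analysis.Analysis"
begin

(* A process on I^2 (I^3) is a function on pairs (s, t) (triples (s, u, t)); only its values on
   I \<times> I (I \<times> I \<times> I) matter.  Suprema are taken in ennreal, so they may be infinite and are 0 when
   I has at most one point. *)

definition hoelder_norm :: "real set \<Rightarrow> real \<Rightarrow> (real \<times> real \<Rightarrow> real) \<Rightarrow> ennreal" where
  "hoelder_norm I a R =
     (SUP (s, t) \<in> {(s, t). s \<in> I \<and> t \<in> I \<and> s \<noteq> t}. ennreal (\<bar>R (s, t)\<bar> / \<bar>t - s\<bar> powr a))"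

definition hoelder_norm2 ::
    "real set \<Rightarrow> real \<Rightarrow> real \<Rightarrow> (real \<times> real \<times> real \<Rightarrow> real) \<Rightarrow> ennreal" where
  "hoelder_norm2 I a b A =
     (SUP (s, u, t) \<in> {(s, u, t). s \<in> I \<and> u \<in> I \<and> t \<in> I \<and> s \<noteq> u \<and> u \<noteq> t}.
        ennreal (\<bar>A (s, u, t)\<bar> / (\<bar>u - s\<bar> powr a * \<bar>t - u\<bar> powr b)))"

definition Nop :: "(real \<times> real \<Rightarrow> real) \<Rightarrow> real \<times> real \<times> real \<Rightarrow> real" where
  "Nop R = (\<lambda>(s, u, t). R (s, t) - R (u, t) - R (s, u))"

definition proc_prod ::
    "(real \<times> real \<Rightarrow> real) \<Rightarrow> (real \<times> real \<Rightarrow> real) \<Rightarrow> real \<times> real \<times> real \<Rightarrow> real" where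
  "proc_prod A B = (\<lambda>(s, u, t). A (s, u) * B (u, t))"

definition OmegaC2 :: "real set \<Rightarrow> real \<Rightarrow> (real \<times> real \<times> real \<Rightarrow> real) set" where
  "OmegaC2 I z = {R. \<exists>(m::nat) A \<rho>.
     (\<forall>i<m. continuous_on (I \<times> I \<times> I) (A i) \<and> bounded (A i ` (I \<times> I \<times> I)) \<and>
            (\<forall>s\<in>I. A i (s, s, s) = 0) \<and>
            0 < \<rho> i \<and> \<rho> i < z \<and> hoelder_norm2 I (\<rho> i) (z - \<rho> i) (A i) < \<infinity>) \<and>
     (\<forall>x \<in> I \<times> I \<times> I. R x = (\<Sum>i<m. A i x))}"

(* B is a basis of V.  The multi-index (b1, ..., bk) is the list [b1, ..., bk] of basis vectors, its
   degree is its length, and an element of the truncated tensor algebra is the family of its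
   coefficients with respect to the basis tensors b1 \<otimes> ... \<otimes> bk, k \<le> n (the scalar 1 for k = 0). *)

definition multi_indices :: "'v set \<Rightarrow> nat \<Rightarrow> 'v list set" where
  "multi_indices B n = {\<mu>. set \<mu> \<subseteq> B \<and> length \<mu> \<le> n}"

definition trunc_tensors :: "'v set \<Rightarrow> nat \<Rightarrow> ('v list \<Rightarrow> real) set" where
  "trunc_tensors B n = {x. \<forall>\<mu>. \<mu> \<notin> multi_indices B n \<longrightarrow> x \<mu> = 0}"

definition component :: "(real \<times> real \<Rightarrow> 'v list \<Rightarrow> real) \<Rightarrow> 'v list \<Rightarrow> real \<times> real \<Rightarrow> real" where
  "component Z \<mu> = (\<lambda>x. Z x \<mu>)"

(* The extensional function space, so that equality of paths is equality on I^2. *)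
definition tensor_paths :: "real set \<Rightarrow> 'v set \<Rightarrow> nat \<Rightarrow> (real \<times> real \<Rightarrow> 'v list \<Rightarrow> real) set" where
  "tensor_paths I B n = (I \<times> I) \<rightarrow>\<^sub>E trunc_tensors B n"

definition finite_p_variation ::
    "real set \<Rightarrow> 'v set \<Rightarrow> real \<Rightarrow> nat \<Rightarrow> (real \<times> real \<Rightarrow> 'v list \<Rightarrow> real) \<Rightarrow> bool" where
  "finite_p_variation I B p n Z \<longleftrightarrow>
     (\<exists>K>0. \<forall>\<mu> \<in> multi_indices B n.
        hoelder_norm I (real (length \<mu>) / p) (component Z \<mu>) \<le> ennreal (K ^ length \<mu>))"

definition splitting_sum ::
    "(real \<times> real \<Rightarrow> 'v list \<Rightarrow> real) \<Rightarrow> 'v list \<Rightarrow> real \<times> real \<times> real \<Rightarrow> real" where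
  "splitting_sum Z \<mu> x =
     (\<Sum>(\<nu>, \<kappa>) \<in> {(\<nu>, \<kappa>). \<nu> @ \<kappa> = \<mu> \<and> \<nu> \<noteq> [] \<and> \<kappa> \<noteq> []}.
        proc_prod (component Z \<nu>) (component Z \<kappa>) x)"

definition multiplicative_path ::
    "real set \<Rightarrow> 'v set \<Rightarrow> nat \<Rightarrow> (real \<times> real \<Rightarrow> 'v list \<Rightarrow> real) \<Rightarrow> bool" where
  "multiplicative_path I B n Z \<longleftrightarrow>
     Z \<in> tensor_paths I B n \<and>
     (\<forall>x \<in> I \<times> I. component Z [] x = 1) \<and>
     (\<forall>\<mu> \<in> multi_indices B n. \<mu> \<noteq> [] \<longrightarrow>
        (\<forall>x \<in> I \<times> I \<times> I. Nop (component Z \<mu>) x = splitting_sum Z \<mu> x))"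

definition almost_multiplicative_path ::
    "real set \<Rightarrow> 'v set \<Rightarrow> real \<Rightarrow> nat \<Rightarrow> (real \<times> real \<Rightarrow> 'v list \<Rightarrow> real) \<Rightarrow> bool" where
  "almost_multiplicative_path I B p n Z \<longleftrightarrow>
     Z \<in> tensor_paths I B n \<and>
     finite_p_variation I B p n Z \<and>
     (\<forall>x \<in> I \<times> I. component Z [] x = 1) \<and>
     \<lfloor>p\<rfloor> \<le> int n \<and>
     (\<exists>z>1. \<forall>\<mu> \<in> multi_indices B n. \<mu> \<noteq> [] \<longrightarrow>
        (\<exists>R \<in> OmegaC2 I z. \<forall>x \<in> I \<times> I \<times> I.
           Nop (component Z \<mu>) x = splitting_sum Z \<mu> x + R x))"

end

theory Submission
  imports Defs
begin

text \<open>
  \<^bold>\<open>Existence.\<close>  The path \<open>Zt\<close> is built degree by degree, each coefficient being obtained by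
  sewing.  Suppose that \<open>Zt\<close> is known below the degree of \<open>\<mu>\<close>, that it satisfies
  Chen's relation \<open>N Zt\<^sup>\<nu> = \<Sum> Zt Zt\<close> there, and that it stays within \<open>K |t - s|\<^sup>z\<close> of \<open>Z\<close>.  The sum
  \<open>S = \<Sum> Zt\<^sup>\<nu> Zt\<^sup>\<kappa>\<close> over the splittings of \<open>\<mu>\<close> is then already determined, and two things hold.

  \<^item> \<open>S\<close> is a cocycle (\<open>splitting_sum_cocycle\<close>), because concatenation is associative.  Freezing its
    first argument at a base point \<open>a\<close> therefore exhibits it as a coboundary: with
    \<open>E s t = S a s t\<close> one has \<open>N E = - S\<close>.
  \<^item> \<open>N Z\<^sup>\<mu> - S\<close> is of size \<open>(|u - s| + |t - u|)\<^sup>z\<close> with \<open>z > 1\<close>.  Indeed \<open>N Z\<^sup>\<mu>\<close> differs from the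
    splitting sum of \<open>Z\<close> by such a remainder, and the two splitting sums differ by such a quantity
    because the factors do and are bounded on the bounded interval \<open>I\<close>.

  So \<open>H = Z\<^sup>\<mu> + E\<close> is almost additive, and the sewing lemma (\<open>sewing\<close>) provides a function \<open>g\<close> with
  \<open>|H s t - (g t - g s)| \<le> K' |t - s|\<^sup>z\<close>.  The coefficient \<open>g t - g s - E s t\<close> satisfies Chen's relation
  exactly and stays close to \<open>Z\<^sup>\<mu>\<close> (\<open>multiplicative_lift\<close>).  The exponent \<open>z\<close> is the same in all
  degrees.  Finite \<open>p\<close>-variation is inherited from \<open>Z\<close>, since \<open>|\<mu>| / p \<le> 1 < z\<close> for
  \<open>|\<mu>| \<le> \<lfloor>p\<rfloor>\<close> and \<open>I\<close> is bounded.

  The sewing lemma has two ingredients.  On finite sets \<open>g\<close> can be taken to be the sum of \<open>H\<close> along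
  consecutive points, and the constant does not depend on the finite set: a partition is
  split at the midpoint of the interval, and \<open>z > 1\<close> turns the
  resulting recursion into a geometric series (\<open>sum_along_partition_bound\<close>).  Tychonoff's theorem then
  yields one function \<open>g\<close> that satisfies all the inequalities at once.

  \<^bold>\<open>Uniqueness.\<close>  If two such paths agree below the degree of \<open>\<mu>\<close>, their \<open>\<mu>\<close>-components have the
  same image under \<open>N\<close>.  The difference is additive and superlinearly small, and repeated bisection
  of the interval shows that it vanishes (\<open>additive_superlinear_eq_0\<close>).
\<close>

section \<open>Pointwise form of the Hoelder norms\<close>

lemma hoelder_norm_le_iff:
  assumes "0 \<le> K"
  shows "hoelder_norm I a R \<le> ennreal K \<longleftrightarrow>
           (\<forall>s\<in>I. \<forall>t\<in>I. s \<noteq> t \<longrightarrow> \<bar>R (s, t)\<bar> \<le> K * \<bar>t - s\<bar> powr a)"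
proof -
  have "ennreal (\<bar>R (s, t)\<bar> / \<bar>t - s\<bar> powr a) \<le> ennreal K \<longleftrightarrow> \<bar>R (s, t)\<bar> \<le> K * \<bar>t - s\<bar> powr a"
    if "s \<noteq> t" for s t
    using that assms by (simp add: ennreal_le_iff divide_le_eq)
  then show ?thesis
    unfolding hoelder_norm_def by (auto simp: SUP_le_iff)
qed

lemma hoelder_norm2_finite_bound:
  assumes "hoelder_norm2 I a b A < \<infinity>"
  obtains C where "0 \<le> C"
    "\<And>s u t. \<lbrakk>s \<in> I; u \<in> I; t \<in> I; s \<noteq> u; u \<noteq> t\<rbrakk> \<Longrightarrow>
       \<bar>A (s, u, t)\<bar> \<le> C * (\<bar>u - s\<bar> powr a * \<bar>t - u\<bar> powr b)"
proof -
  obtain C where C: "0 \<le> C" "hoelder_norm2 I a b A = ennreal C"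
    using assms by (cases "hoelder_norm2 I a b A") auto
  have "\<bar>A (s, u, t)\<bar> \<le> C * (\<bar>u - s\<bar> powr a * \<bar>t - u\<bar> powr b)"
    if "s \<in> I" "u \<in> I" "t \<in> I" "s \<noteq> u" "u \<noteq> t" for s u t
  proof -
    have "ennreal (\<bar>A (s, u, t)\<bar> / (\<bar>u - s\<bar> powr a * \<bar>t - u\<bar> powr b)) \<le> ennreal C"
      unfolding C(2)[symmetric] hoelder_norm2_def
      by (rule SUP_upper2[of "(s, u, t)"]) (use that in auto)
    moreover have "0 < \<bar>u - s\<bar> powr a * \<bar>t - u\<bar> powr b"
      using that by simp
    ultimately show ?thesis
      using C(1) by (simp add: ennreal_le_iff divide_le_eq)
  qed
  with C(1) show ?thesis by (rule that)
qed

lemma powr_le_powr_bounded: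
  fixes x :: real
  assumes "0 \<le> x" "x \<le> L" "a \<le> b"
  shows "x powr b \<le> L powr (b - a) * x powr a"
proof -
  have "x powr b = x powr (b - a) * x powr a"
    by (simp flip: powr_add)
  also have "\<dots> \<le> L powr (b - a) * x powr a"
    using assms by (intro mult_right_mono powr_mono2) auto
  finally show ?thesis .
qed

text \<open>
  The exponents \<open>\<rho> i\<close>, \<open>z - \<rho> i\<close> may vary with the summand.  Bounding \<open>|u - s|\<close> and \<open>|t - u|\<close> by
  their sum leaves only the common total exponent \<open>z\<close>.
\<close>
lemma OmegaC2_bound:
  assumes "R \<in> OmegaC2 I z"
  obtains C where "0 \<le> C"
    "\<And>s u t. \<lbrakk>s \<in> I; u \<in> I; t \<in> I; s \<noteq> u; u \<noteq> t\<rbrakk> \<Longrightarrow>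
       \<bar>R (s, u, t)\<bar> \<le> C * (\<bar>u - s\<bar> + \<bar>t - u\<bar>) powr z"
proof -
  obtain m :: nat and A \<rho> where
    A: "\<And>i. i < m \<Longrightarrow> 0 < \<rho> i \<and> \<rho> i < z \<and> hoelder_norm2 I (\<rho> i) (z - \<rho> i) (A i) < \<infinity>"
    and R: "\<And>x. x \<in> I \<times> I \<times> I \<Longrightarrow> R x = (\<Sum>i<m. A i x)"
    using assms unfolding OmegaC2_def by blast
  have "\<forall>i\<in>{..<m}. \<exists>c\<ge>0. \<forall>s\<in>I. \<forall>u\<in>I. \<forall>t\<in>I. s \<noteq> u \<longrightarrow> u \<noteq> t \<longrightarrow>
          \<bar>A i (s, u, t)\<bar> \<le> c * (\<bar>u - s\<bar> powr \<rho> i * \<bar>t - u\<bar> powr (z - \<rho> i))"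
  proof
    fix i assume "i \<in> {..<m}"
    with A have "hoelder_norm2 I (\<rho> i) (z - \<rho> i) (A i) < \<infinity>" by auto
    from hoelder_norm2_finite_bound[OF this]
    show "\<exists>c\<ge>0. \<forall>s\<in>I. \<forall>u\<in>I. \<forall>t\<in>I. s \<noteq> u \<longrightarrow> u \<noteq> t \<longrightarrow>
          \<bar>A i (s, u, t)\<bar> \<le> c * (\<bar>u - s\<bar> powr \<rho> i * \<bar>t - u\<bar> powr (z - \<rho> i))"
      by metis
  qed
  from bchoice[OF this] obtain c where c: "\<And>i. i < m \<Longrightarrow> 0 \<le> c i"
    "\<And>i s u t. \<lbrakk>i < m; s \<in> I; u \<in> I; t \<in> I; s \<noteq> u; u \<noteq> t\<rbrakk> \<Longrightarrow>
       \<bar>A i (s, u, t)\<bar> \<le> c i * (\<bar>u - s\<bar> powr \<rho> i * \<bar>t - u\<bar> powr (z - \<rho> i))"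
    by (metis lessThan_iff)
  show ?thesis
  proof
    show "0 \<le> (\<Sum>i<m. c i)" using c(1) by (intro sum_nonneg) auto
  next
    fix s u t assume I: "s \<in> I" "u \<in> I" "t \<in> I" and ne: "s \<noteq> u" "u \<noteq> t"
    define d where "d = \<bar>u - s\<bar> + \<bar>t - u\<bar>"
    have "\<bar>A i (s, u, t)\<bar> \<le> c i * d powr z" if "i < m" for i
    proof -
      have "\<bar>u - s\<bar> powr \<rho> i * \<bar>t - u\<bar> powr (z - \<rho> i) \<le> d powr \<rho> i * d powr (z - \<rho> i)"
        using A[OF that] by (intro mult_mono powr_mono2) (auto simp: d_def)
      also have "\<dots> = d powr z" by (simp flip: powr_add)
      finally show ?thesis
        using c(2)[OF that I ne] c(1)[OF that] by (meson mult_left_mono order_trans)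
    qed
    then have "(\<Sum>i<m. \<bar>A i (s, u, t)\<bar>) \<le> (\<Sum>i<m. c i * d powr z)"
      by (intro sum_mono) auto
    then show "\<bar>R (s, u, t)\<bar> \<le> (\<Sum>i<m. c i) * (\<bar>u - s\<bar> + \<bar>t - u\<bar>) powr z"
      using I order_trans[OF sum_abs[of "\<lambda>i. A i (s, u, t)" "{..<m}"]]
      by (simp add: R sum_distrib_right d_def)
  qed
qed

section \<open>The sewing lemma\<close>

text \<open>
  Summing an almost additive \<open>H\<close> along a partition changes it by at most a multiple of the \<open>z\<close>-th power
  of the length, whatever the partition.  Cut at the last point \<open>x l\<close> of the left half: the pieces
  \<open>[x i, x l]\<close> and \<open>[x (Suc l), x j]\<close> have at most half the length \<open>L\<close>, and inserting the two points
  \<open>x l\<close>, \<open>x (Suc l)\<close> costs \<open>2 C L\<^sup>z\<close>.  So a constant \<open>K\<close> propagates through the induction if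
  \<open>2 K (L / 2)\<^sup>z + 2 C L\<^sup>z \<le> K L\<^sup>z\<close>, which gives the value of \<open>K\<close> below.
\<close>
lemma sum_along_partition_bound:
  fixes H :: "real \<Rightarrow> real \<Rightarrow> real" and x :: "nat \<Rightarrow> real"
  assumes z: "1 < z" and C: "0 \<le> C"
    and H: "\<And>s u t. \<lbrakk>s \<in> I; u \<in> I; t \<in> I\<rbrakk> \<Longrightarrow>
              \<bar>H s t - H u t - H s u\<bar> \<le> C * (\<bar>u - s\<bar> + \<bar>t - u\<bar>) powr z"
    and "i \<le> j"
    and I: "\<And>l. \<lbrakk>i \<le> l; l \<le> j\<rbrakk> \<Longrightarrow> x l \<in> I"
    and x: "\<And>l m. \<lbrakk>i \<le> l; l \<le> m; m \<le> j\<rbrakk> \<Longrightarrow> x l \<le> x m"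
  shows "\<bar>H (x i) (x j) - (\<Sum>l\<in>{i..<j}. H (x l) (x (Suc l)))\<bar>
           \<le> 2 * C / (1 - 2 powr (1 - z)) * (x j - x i) powr z"
  using \<open>i \<le> j\<close> I x
proof (induction "j - i" arbitrary: i j rule: less_induct)
  case less
  define K where "K = 2 * C / (1 - 2 powr (1 - z))"
  have q: "2 powr (1 - z) < (1::real)"
    using z by (simp add: powr_less_one)
  then have K0: "0 \<le> K" using C by (simp add: K_def)
  \<comment> \<open>The constant \<open>K\<close> solves the recursion of the bisection with equality.\<close>
  have Keq: "2 * C + K * 2 powr (1 - z) = K"
  proof -
    have "K * (1 - 2 powr (1 - z)) = 2 * C" using z by (simp add: K_def)
    then show ?thesis by (simp add: algebra_simps)
  qed
  show ?case
  proof (cases "i = j")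
    case True
    have "\<bar>H (x i) (x i)\<bar> \<le> 0"
      using H[of "x i" "x i" "x i"] less.prems(2)[of i] True z by simp
    with True show ?thesis by simp
  next
    case False
    with less.prems have "i < j" by simp
    define L where "L = x j - x i"
    have L0: "0 \<le> L" using less.prems(3)[of i j] \<open>i < j\<close> by (simp add: L_def)
    define l where "l = Max {l \<in> {i..<j}. x l \<le> x i + L / 2}"
    have "l \<in> {l \<in> {i..<j}. x l \<le> x i + L / 2}"
      unfolding l_def using \<open>i < j\<close> L0 by (intro Max_in) (auto intro: exI[of _ i])
    then have l: "i \<le> l" "l < j" "x l \<le> x i + L / 2" by auto
    have l': "x j - x (Suc l) \<le> L / 2"
    proof (cases "Suc l = j")
      case False
      have "x i + L / 2 < x (Suc l)"
      proof (rule ccontr)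
        assume "\<not> x i + L / 2 < x (Suc l)"
        then have "Suc l \<in> {l \<in> {i..<j}. x l \<le> x i + L / 2}" using l False by auto
        then have "Suc l \<le> l" unfolding l_def by (intro Max_ge) auto
        then show False by simp
      qed
      then show ?thesis by (simp add: L_def field_simps)
    qed (use L0 in simp)
    have xI: "x i \<in> I" "x j \<in> I" "x l \<in> I" "x (Suc l) \<in> I"
      using less.prems(2) l by auto
    have ord: "x i \<le> x l" "x l \<le> x (Suc l)" "x (Suc l) \<le> x j"
      using less.prems(3) l by auto
    have half: "K * y powr z \<le> K * (L / 2) powr z" if "0 \<le> y" "y \<le> L / 2" for y
      using that K0 z by (intro mult_left_mono powr_mono2) auto
    have 1: "\<bar>H (x i) (x l) - (\<Sum>l\<in>{i..<l}. H (x l) (x (Suc l)))\<bar> \<le> K * (L / 2) powr z"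
      using less.hyps[of l i] less.prems l half[of "x l - x i"] ord unfolding K_def by fastforce
    have 2: "\<bar>H (x (Suc l)) (x j) - (\<Sum>l\<in>{Suc l..<j}. H (x l) (x (Suc l)))\<bar> \<le> K * (L / 2) powr z"
      using less.hyps[of j "Suc l"] less.prems l half[of "x j - x (Suc l)"] ord l'
      unfolding K_def by fastforce
    have 3: "\<bar>H (x i) (x j) - H (x l) (x j) - H (x i) (x l)\<bar> \<le> C * L powr z"
      using H[of "x i" "x l" "x j"] xI ord by (simp add: L_def)
    have "\<bar>H (x l) (x j) - H (x (Suc l)) (x j) - H (x l) (x (Suc l))\<bar> \<le> C * (x j - x l) powr z"
      using H[of "x l" "x (Suc l)" "x j"] xI ord by simp
    also have "\<dots> \<le> C * L powr z"
      using C ord z by (intro mult_left_mono powr_mono2) (auto simp: L_def)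
    finally have 4: "\<bar>H (x l) (x j) - H (x (Suc l)) (x j) - H (x l) (x (Suc l))\<bar> \<le> C * L powr z" .
    have "{i..<j} = {i..<l} \<union> insert l {Suc l..<j}" using l by auto
    then have S: "(\<Sum>l\<in>{i..<j}. H (x l) (x (Suc l))) = (\<Sum>l\<in>{i..<l}. H (x l) (x (Suc l)))
        + H (x l) (x (Suc l)) + (\<Sum>l\<in>{Suc l..<j}. H (x l) (x (Suc l)))"
      by (simp add: sum.union_disjoint)
    have "2 * (K * (L / 2) powr z) = K * 2 powr (1 - z) * L powr z"
      using L0 by (simp add: powr_divide powr_diff)
    then have "2 * (K * (L / 2) powr z) + 2 * (C * L powr z) = (2 * C + K * 2 powr (1 - z)) * L powr z"
      by (simp add: algebra_simps)
    then have "2 * (K * (L / 2) powr z) + 2 * (C * L powr z) = K * L powr z"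
      unfolding Keq .
    with 1 2 3 4 S show ?thesis
      unfolding K_def[symmetric] L_def[symmetric] by linarith
  qed
qed

text \<open>
  Summing along the points of \<open>P\<close> in increasing order gives \<open>g\<close>.  The summand \<open>2 powr z\<close> of the
  constant pays for the pairs with \<open>t < s\<close>, where \<open>H s t\<close> is compared with \<open>- H t s\<close> through the triple
  \<open>(s, t, s)\<close>.
\<close>
lemma sewing_finite:
  fixes H :: "real \<Rightarrow> real \<Rightarrow> real"
  assumes z: "1 < z" and C: "0 \<le> C"
    and H: "\<And>s u t. \<lbrakk>s \<in> I; u \<in> I; t \<in> I\<rbrakk> \<Longrightarrow>
              \<bar>H s t - H u t - H s u\<bar> \<le> C * (\<bar>u - s\<bar> + \<bar>t - u\<bar>) powr z"
    and P: "finite P" "P \<subseteq> I"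
  shows "\<exists>g. \<forall>s\<in>P. \<forall>t\<in>P. \<bar>H s t - (g t - g s)\<bar>
           \<le> (2 / (1 - 2 powr (1 - z)) + 2 powr z) * C * \<bar>t - s\<bar> powr z"
proof -
  define xs where "xs = sorted_list_of_set P"
  have xs: "sorted xs" "set xs = P" using P by (auto simp: xs_def)
  have "\<forall>t\<in>P. \<exists>i<length xs. xs ! i = t" using xs by (metis in_set_conv_nth)
  then obtain idx where idx: "\<And>t. t \<in> P \<Longrightarrow> idx t < length xs" "\<And>t. t \<in> P \<Longrightarrow> xs ! idx t = t"
    by metis
  define g where "g t = (\<Sum>l\<in>{0..<idx t}. H (xs ! l) (xs ! Suc l))" for t
  define K where "K = 2 * C / (1 - 2 powr (1 - z))"
  have q: "2 powr (1 - z) < (1::real)"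
    using z by (simp add: powr_less_one)
  have K: "(2 / (1 - 2 powr (1 - z)) + 2 powr z) * C = K + C * 2 powr z"
    using q by (simp add: K_def field_simps)
  have fwd: "s \<le> t \<and> \<bar>H s t - (g t - g s)\<bar> \<le> K * \<bar>t - s\<bar> powr z"
    if "s \<in> P" "t \<in> P" "idx s \<le> idx t" for s t
  proof -
    have st: "s \<le> t"
      using xs(1) idx that by (metis sorted_nth_mono)
    have "g t - g s = (\<Sum>l\<in>{idx s..<idx t}. H (xs ! l) (xs ! Suc l))"
      using sum.atLeastLessThan_concat[of 0 "idx s" "idx t" "\<lambda>l. H (xs ! l) (xs ! Suc l)"] that(3)
      by (simp add: g_def)
    moreover have "\<bar>H (xs ! idx s) (xs ! idx t) - (\<Sum>l\<in>{idx s..<idx t}. H (xs ! l) (xs ! Suc l))\<bar>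
        \<le> K * (xs ! idx t - xs ! idx s) powr z"
      unfolding K_def
    proof (rule sum_along_partition_bound[OF z C H that(3)])
      fix l assume "idx s \<le> l" "l \<le> idx t"
      then have "l < length xs" using idx(1)[OF that(2)] by simp
      then show "xs ! l \<in> I" using xs(2) P(2) nth_mem by blast
    next
      fix l m assume "idx s \<le> l" "l \<le> m" "m \<le> idx t"
      then show "xs ! l \<le> xs ! m" using idx(1)[OF that(2)] xs(1) by (intro sorted_nth_mono) auto
    qed
    ultimately show ?thesis using idx(2) that st by simp
  qed
  have "\<bar>H s t - (g t - g s)\<bar> \<le> (K + C * 2 powr z) * \<bar>t - s\<bar> powr z"
    if st: "s \<in> P" "t \<in> P" for s t
  proof (cases "idx s \<le> idx t")
    case True
    have "0 \<le> C * 2 powr z * \<bar>t - s\<bar> powr z" using C by simp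
    with fwd[OF st True] show ?thesis unfolding distrib_right by linarith
  next
    case False
    then have le: "idx t \<le> idx s" by simp
    have ts: "\<bar>H t s - (g s - g t)\<bar> \<le> K * \<bar>t - s\<bar> powr z"
      using fwd[OF st(2,1) le] unfolding abs_minus_commute[of t s] by blast
    have sI: "s \<in> I" "t \<in> I" using st P by auto
    have "H s s = 0" using H[of s s s] sI z by simp
    moreover have "\<bar>H s s - H t s - H s t\<bar> \<le> C * (2 * \<bar>t - s\<bar>) powr z"
      using H[of s t s] sI by (simp add: abs_minus_commute)
    ultimately show ?thesis using ts
      by (simp add: powr_mult algebra_simps abs_le_iff)
  qed
  then show ?thesis unfolding K by blast
qed

text \<open>
  Each inequality defines a closed set of functions \<open>g\<close>, and finitely many of these sets always meet.
  Normalised by \<open>g a = 0\<close>, the values \<open>g t\<close> are confined to a compact interval around \<open>H a t\<close>, so by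
  Tychonoff's theorem all these sets meet.
\<close>
lemma sewing:
  fixes H :: "real \<Rightarrow> real \<Rightarrow> real"
  assumes z: "1 < z" and C: "0 \<le> C"
    and H: "\<And>s u t. \<lbrakk>s \<in> I; u \<in> I; t \<in> I\<rbrakk> \<Longrightarrow>
              \<bar>H s t - H u t - H s u\<bar> \<le> C * (\<bar>u - s\<bar> + \<bar>t - u\<bar>) powr z"
  shows "\<exists>g. \<forall>s\<in>I. \<forall>t\<in>I. \<bar>H s t - (g t - g s)\<bar>
           \<le> (2 / (1 - 2 powr (1 - z)) + 2 powr z) * C * \<bar>t - s\<bar> powr z"
proof (cases "I = {}")
  case False
  then obtain a where a: "a \<in> I" by blast
  define c where "c s t = (2 / (1 - 2 powr (1 - z)) + 2 powr z) * C * \<bar>t - s\<bar> powr z" for s t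
  define F where "F = (\<lambda>(s, t). {g :: real \<Rightarrow> real. \<bar>H s t - (g t - g s)\<bar> \<le> c s t})"
  define S where "S t = (if t \<in> I then {H a t - c a t..H a t + c a t} else {0})" for t
  have cpt: "compact (Pi\<^sub>E UNIV S)"
    unfolding compactin_euclidean_iff[symmetric] euclidean_product_topology[symmetric]
    by (auto simp: compactin_PiE S_def)
  have "Pi\<^sub>E UNIV S \<inter> (\<Inter>x\<in>I \<times> I. F x) \<noteq> {}"
  proof (rule compact_imp_fip_image[OF cpt])
    fix x assume "x \<in> I \<times> I"
    show "closed (F x)"
      unfolding F_def split_def by (intro closed_Collect_le continuous_intros continuous_on_product_coordinates)
  next
    fix Q assume Q: "finite Q" "Q \<subseteq> I \<times> I"
    define P where "P = insert a (fst ` Q \<union> snd ` Q)"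
    have P: "finite P" "P \<subseteq> I" using Q a by (auto simp: P_def)
    obtain g where g: "\<And>s t. \<lbrakk>s \<in> P; t \<in> P\<rbrakk> \<Longrightarrow> \<bar>H s t - (g t - g s)\<bar> \<le> c s t"
      using sewing_finite[OF z C H P] unfolding c_def by blast
    \<comment> \<open>Off \<open>P\<close> any value in the compact box will do.\<close>
    define f where "f t = (if t \<in> P then g t - g a else if t \<in> I then H a t else 0)" for t
    have c0: "0 \<le> c s t" for s t
      using z C by (simp add: c_def powr_less_one less_imp_le)
    have "f t \<in> S t" for t
    proof (cases "t \<in> P")
      case True
      moreover have "a \<in> P" by (simp add: P_def)
      ultimately have "\<bar>H a t - (g t - g a)\<bar> \<le> c a t" "t \<in> I" using g P(2) by auto
      with True show ?thesis by (simp add: f_def S_def abs_le_iff)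
    qed (use c0[of a t] in \<open>simp add: f_def S_def\<close>)
    then have "f \<in> Pi\<^sub>E UNIV S" by auto
    moreover have "f \<in> F x" if "x \<in> Q" for x
    proof -
      obtain s t where "x = (s, t)" by force
      moreover have "s \<in> P" "t \<in> P" using that \<open>x = (s, t)\<close> unfolding P_def by force+
      ultimately show ?thesis using g[of s t] by (simp add: F_def f_def)
    qed
    ultimately show "Pi\<^sub>E UNIV S \<inter> (\<Inter>x\<in>Q. F x) \<noteq> {}" by blast
  qed
  then obtain g where "\<And>s t. \<lbrakk>s \<in> I; t \<in> I\<rbrakk> \<Longrightarrow> g \<in> F (s, t)" by blast
  then show ?thesis by (auto simp: F_def c_def)
qed simp

section \<open>Additive processes of superlinear decay\<close>

text \<open>
  Bisecting an interval doubles the number of terms and multiplies each bound by \<open>2 powr (- z)\<close>, so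
  \<open>n\<close> bisections improve the bound by the factor \<open>(2 powr (1 - z)) ^ n\<close>, which tends to \<open>0\<close>.  There
  are two exponents because two different approximations of the same path come each with their own.
\<close>
lemma additive_superlinear_eq_0:
  fixes D :: "real \<Rightarrow> real \<Rightarrow> real"
  assumes "is_interval I"
    and add: "\<And>s u t. \<lbrakk>s \<in> I; u \<in> I; t \<in> I\<rbrakk> \<Longrightarrow> D s t = D s u + D u t"
    and bound: "\<And>s t. \<lbrakk>s \<in> I; t \<in> I; s \<noteq> t\<rbrakk> \<Longrightarrow> \<bar>D s t\<bar> \<le> K * \<bar>t - s\<bar> powr z + K' * \<bar>t - s\<bar> powr z'"
    and z: "1 < z" "1 < z'" and st: "s \<in> I" "t \<in> I"
  shows "D s t = 0"
proof -
  have "\<bar>D s t\<bar> \<le> K * \<bar>t - s\<bar> powr z * (2 powr (1 - z)) ^ n + K' * \<bar>t - s\<bar> powr z' * (2 powr (1 - z')) ^ n"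
    for n
    using st
  proof (induction n arbitrary: s t)
    case 0
    have "D s s = 0" using add[of s s s] 0 by simp
    then show ?case using bound[of s t] 0 by (cases "s = t") auto
  next
    case (Suc n)
    define m where "m = (s + t) / 2"
    have m: "m \<in> I"
      using assms(1) Suc.prems mem_is_interval_1_I[of I s t m] mem_is_interval_1_I[of I t s m]
      by (cases "s \<le> t") (auto simp: m_def)
    have d: "\<bar>m - s\<bar> = \<bar>t - s\<bar> / 2" "\<bar>t - m\<bar> = \<bar>t - s\<bar> / 2"
      by (auto simp: m_def field_simps abs_if)
    have h: "2 * (\<bar>t - s\<bar> / 2) powr y = \<bar>t - s\<bar> powr y * 2 powr (1 - y)" for y
      by (simp add: powr_divide powr_diff)
    define b where "b = K * (\<bar>t - s\<bar> / 2) powr z * (2 powr (1 - z)) ^ n + K' * (\<bar>t - s\<bar> / 2) powr z' * (2 powr (1 - z')) ^ n"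
    have "\<bar>D s t\<bar> \<le> 2 * b"
      using Suc.IH[OF Suc.prems(1) m] Suc.IH[OF m Suc.prems(2)] add[OF Suc.prems(1) m Suc.prems(2)]
      unfolding d b_def[symmetric] by linarith
    also have "2 * b = K * (2 * (\<bar>t - s\<bar> / 2) powr z) * (2 powr (1 - z)) ^ n
        + K' * (2 * (\<bar>t - s\<bar> / 2) powr z') * (2 powr (1 - z')) ^ n"
      by (simp add: b_def algebra_simps)
    finally show ?case unfolding h by (simp add: algebra_simps)
  qed
  moreover have "(\<lambda>n. K * \<bar>t - s\<bar> powr z * (2 powr (1 - z)) ^ n + K' * \<bar>t - s\<bar> powr z' * (2 powr (1 - z')) ^ n)
      \<longlonglongrightarrow> K * \<bar>t - s\<bar> powr z * 0 + K' * \<bar>t - s\<bar> powr z' * 0"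
    using z by (intro tendsto_intros LIMSEQ_power_zero) (auto simp: powr_less_one)
  ultimately have "\<bar>D s t\<bar> \<le> 0"
    by (intro LIMSEQ_le_const[of _ 0]) auto
  then show ?thesis by simp
qed

section \<open>Splitting sums\<close>

lemma splitting_sum_take_drop:
  "splitting_sum Z \<mu> (s, u, t) = (\<Sum>i\<in>{1..<length \<mu>}. Z (s, u) (take i \<mu>) * Z (u, t) (drop i \<mu>))"
  unfolding splitting_sum_def proc_prod_def component_def
  by (rule sum.reindex_bij_witness[of _ "\<lambda>i. (take i \<mu>, drop i \<mu>)" "\<lambda>(\<nu>, \<kappa>). length \<nu>"])
     (auto simp: Suc_le_eq)

text \<open>
  Chen's relation, applied to prefixes on the left and to suffixes on the right, expands both sides
  into the same terms: products \<open>W (s, u) W (v, t)\<close> over the cuts of \<open>\<mu>\<close> into two words, and products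
  \<open>W (s, u) W (u, v) W (v, t)\<close> over the cuts into three words.  For the latter, the left side cuts
  first at \<open>i\<close> and then the prefix at \<open>j\<close>, the right side first at \<open>j\<close> and then the suffix at \<open>i\<close>.
\<close>
lemma splitting_sum_cocycle:
  assumes take: "\<And>i s u t. \<lbrakk>0 < i; i < length \<mu>; s \<in> I; u \<in> I; t \<in> I\<rbrakk> \<Longrightarrow>
      Nop (component W (take i \<mu>)) (s, u, t) = splitting_sum W (take i \<mu>) (s, u, t)"
    and drop: "\<And>i s u t. \<lbrakk>0 < i; i < length \<mu>; s \<in> I; u \<in> I; t \<in> I\<rbrakk> \<Longrightarrow>
      Nop (component W (drop i \<mu>)) (s, u, t) = splitting_sum W (drop i \<mu>) (s, u, t)"
    and I: "s \<in> I" "u \<in> I" "v \<in> I" "t \<in> I"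
  shows "splitting_sum W \<mu> (s, v, t) - splitting_sum W \<mu> (u, v, t)
       = splitting_sum W \<mu> (s, u, t) - splitting_sum W \<mu> (s, u, v)"
proof -
  let ?n = "length \<mu>"
  let ?T = "\<lambda>j i. W (s, u) (take j \<mu>) * W (u, v) (take (i - j) (drop j \<mu>)) * W (v, t) (drop i \<mu>)"
  have l: "(W (s, v) (take i \<mu>) - W (u, v) (take i \<mu>)) * W (v, t) (drop i \<mu>)
      = W (s, u) (take i \<mu>) * W (v, t) (drop i \<mu>) + (\<Sum>j\<in>{1..<i}. ?T j i)"
    if "i \<in> {1..<?n}" for i
  proof -
    have "W (s, v) (take i \<mu>) - W (u, v) (take i \<mu>)
        = W (s, u) (take i \<mu>) + splitting_sum W (take i \<mu>) (s, u, v)"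
      using take[of i s u v] I that by (simp add: Nop_def component_def)
    then show ?thesis
      using that by (simp add: splitting_sum_take_drop min_def drop_take sum_distrib_right distrib_right)
  qed
  have r: "W (s, u) (take j \<mu>) * (W (u, t) (drop j \<mu>) - W (u, v) (drop j \<mu>))
      = W (s, u) (take j \<mu>) * W (v, t) (drop j \<mu>) + (\<Sum>i\<in>{j<..<?n}. ?T j i)"
    if "j \<in> {1..<?n}" for j
  proof -
    have "W (u, t) (drop j \<mu>) - W (u, v) (drop j \<mu>)
        = W (v, t) (drop j \<mu>) + splitting_sum W (drop j \<mu>) (u, v, t)"
      using drop[of j u v t] I that by (simp add: Nop_def component_def)
    moreover have "W (s, u) (take j \<mu>) * splitting_sum W (drop j \<mu>) (u, v, t) = (\<Sum>i\<in>{j<..<?n}. ?T j i)"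
      unfolding splitting_sum_take_drop sum_distrib_left
      by (rule sum.reindex_bij_witness[of _ "\<lambda>i. i - j" "\<lambda>l. l + j"]) (auto simp: mult.assoc)
    ultimately show ?thesis by (simp add: distrib_left)
  qed
  have "splitting_sum W \<mu> (s, v, t) - splitting_sum W \<mu> (u, v, t)
      = (\<Sum>i\<in>{1..<?n}. W (s, u) (take i \<mu>) * W (v, t) (drop i \<mu>)) + (\<Sum>i\<in>{1..<?n}. \<Sum>j\<in>{1..<i}. ?T j i)"
    unfolding splitting_sum_take_drop sum_subtractf[symmetric] sum.distrib[symmetric]
    by (intro sum.cong refl) (simp only: l left_diff_distrib[symmetric])
  moreover have "splitting_sum W \<mu> (s, u, t) - splitting_sum W \<mu> (s, u, v)
      = (\<Sum>j\<in>{1..<?n}. W (s, u) (take j \<mu>) * W (v, t) (drop j \<mu>)) + (\<Sum>j\<in>{1..<?n}. \<Sum>i\<in>{j<..<?n}. ?T j i)"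
    unfolding splitting_sum_take_drop sum_subtractf[symmetric] sum.distrib[symmetric]
    by (intro sum.cong refl) (simp only: r right_diff_distrib[symmetric])
  moreover have "(\<Sum>i\<in>{1..<?n}. \<Sum>j\<in>{1..<i}. ?T j i) = (\<Sum>j\<in>{1..<?n}. \<Sum>i\<in>{j<..<?n}. ?T j i)"
    unfolding sum.Sigma[OF finite_atLeastLessThan ballI[OF finite_atLeastLessThan]]
      sum.Sigma[OF finite_atLeastLessThan ballI[OF finite_greaterThanLessThan]]
    by (rule sum.reindex_bij_witness[of _ "\<lambda>(j, i). (i, j)" "\<lambda>(i, j). (j, i)"]) auto
  ultimately show ?thesis by simp
qed

text \<open>
  Closeness passes to products by \<open>x y - v w = (x - v) y + v (y - w)\<close>.  The boundedness of
  the other factor is enough, so the exponent \<open>z\<close> survives.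
\<close>
lemma splitting_sum_diff_bound:
  assumes K: "0 \<le> K" and M: "0 \<le> M" and z: "0 \<le> z"
    and diff: "\<And>i s t. \<lbrakk>0 < i; i < length \<mu>; s \<in> I; t \<in> I\<rbrakk> \<Longrightarrow>
       \<bar>Z (s, t) (take i \<mu>) - W (s, t) (take i \<mu>)\<bar> \<le> K * \<bar>t - s\<bar> powr z \<and>
       \<bar>Z (s, t) (drop i \<mu>) - W (s, t) (drop i \<mu>)\<bar> \<le> K * \<bar>t - s\<bar> powr z"
    and bounded: "\<And>i s t. \<lbrakk>0 < i; i < length \<mu>; s \<in> I; t \<in> I\<rbrakk> \<Longrightarrow>
       \<bar>W (s, t) (take i \<mu>)\<bar> \<le> M \<and> \<bar>Z (s, t) (drop i \<mu>)\<bar> \<le> M"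
    and I: "s \<in> I" "u \<in> I" "t \<in> I"
  shows "\<bar>splitting_sum Z \<mu> (s, u, t) - splitting_sum W \<mu> (s, u, t)\<bar>
           \<le> real (length \<mu>) * (2 * K * M) * (\<bar>u - s\<bar> + \<bar>t - u\<bar>) powr z"
proof -
  let ?d = "\<bar>u - s\<bar> + \<bar>t - u\<bar>"
  have summand: "\<bar>Z (s, u) (take i \<mu>) * Z (u, t) (drop i \<mu>) - W (s, u) (take i \<mu>) * W (u, t) (drop i \<mu>)\<bar>
      \<le> 2 * K * M * ?d powr z" if "i \<in> {1..<length \<mu>}" for i
  proof -
    have i: "0 < i" "i < length \<mu>" using that by auto
    have mono: "K * \<bar>u - s\<bar> powr z \<le> K * ?d powr z" "K * \<bar>t - u\<bar> powr z \<le> K * ?d powr z"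
      using K z by (auto intro!: mult_left_mono powr_mono2)
    have "\<bar>(Z (s, u) (take i \<mu>) - W (s, u) (take i \<mu>)) * Z (u, t) (drop i \<mu>)\<bar> \<le> K * ?d powr z * M"
      unfolding abs_mult
      using diff[OF i I(1,2)] bounded[OF i I(2,3)] mono K by (intro mult_mono) auto
    moreover have "\<bar>W (s, u) (take i \<mu>) * (Z (u, t) (drop i \<mu>) - W (u, t) (drop i \<mu>))\<bar> \<le> M * (K * ?d powr z)"
      unfolding abs_mult
      using diff[OF i I(2,3)] bounded[OF i I(1,2)] mono M by (intro mult_mono) auto
    moreover have "Z (s, u) (take i \<mu>) * Z (u, t) (drop i \<mu>) - W (s, u) (take i \<mu>) * W (u, t) (drop i \<mu>)
        = (Z (s, u) (take i \<mu>) - W (s, u) (take i \<mu>)) * Z (u, t) (drop i \<mu>)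
          + W (s, u) (take i \<mu>) * (Z (u, t) (drop i \<mu>) - W (u, t) (drop i \<mu>))"
      by (simp add: algebra_simps)
    ultimately show ?thesis by (simp add: algebra_simps)
  qed
  have "\<bar>splitting_sum Z \<mu> (s, u, t) - splitting_sum W \<mu> (s, u, t)\<bar>
      \<le> (\<Sum>i\<in>{1..<length \<mu>}. 2 * K * M * ?d powr z)"
    unfolding splitting_sum_take_drop sum_subtractf[symmetric]
    by (rule order_trans[OF sum_abs sum_mono]) (rule summand)
  also have "\<dots> = real (length \<mu> - 1) * (2 * K * M * ?d powr z)" by simp
  also have "\<dots> \<le> real (length \<mu>) * (2 * K * M * ?d powr z)"
    using K M by (intro mult_right_mono) auto
  finally show ?thesis by (simp add: mult.assoc)
qed

section \<open>Construction of the multiplicative path\<close>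

text \<open>
  One step of the construction: a coefficient at \<open>\<mu>\<close>, given those at the proper prefixes and suffixes
  of \<open>\<mu>\<close>.  Up to the coboundary \<open>E\<close>, which absorbs the splitting sum, this is the sewing lemma.
\<close>
lemma multiplicative_lift:
  assumes z: "1 < z" and C: "0 \<le> C"
    and take: "\<And>i s u t. \<lbrakk>0 < i; i < length \<mu>; s \<in> I; u \<in> I; t \<in> I\<rbrakk> \<Longrightarrow>
      Nop (component W (take i \<mu>)) (s, u, t) = splitting_sum W (take i \<mu>) (s, u, t)"
    and drop: "\<And>i s u t. \<lbrakk>0 < i; i < length \<mu>; s \<in> I; u \<in> I; t \<in> I\<rbrakk> \<Longrightarrow>
      Nop (component W (drop i \<mu>)) (s, u, t) = splitting_sum W (drop i \<mu>) (s, u, t)"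
    and Z: "\<And>s u t. \<lbrakk>s \<in> I; u \<in> I; t \<in> I\<rbrakk> \<Longrightarrow>
      \<bar>Nop (component Z \<mu>) (s, u, t) - splitting_sum W \<mu> (s, u, t)\<bar> \<le> C * (\<bar>u - s\<bar> + \<bar>t - u\<bar>) powr z"
  shows "\<exists>f. (\<forall>s\<in>I. \<forall>u\<in>I. \<forall>t\<in>I. Nop f (s, u, t) = splitting_sum W \<mu> (s, u, t)) \<and>
             (\<forall>s\<in>I. \<forall>t\<in>I. \<bar>Z (s, t) \<mu> - f (s, t)\<bar>
                \<le> (2 / (1 - 2 powr (1 - z)) + 2 powr z) * C * \<bar>t - s\<bar> powr z)"
proof (cases "I = {}")
  case False
  then obtain a where a: "a \<in> I" by blast
  define E where "E s t = splitting_sum W \<mu> (a, s, t)" for s t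
  have E: "E u t + E s u - E s t = splitting_sum W \<mu> (s, u, t)"
    if "s \<in> I" "u \<in> I" "t \<in> I" for s u t
    using splitting_sum_cocycle[of \<mu> I W a s u t, OF take drop a that] by (simp add: E_def)
  have HE: "\<bar>(Z (s, t) \<mu> + E s t) - (Z (u, t) \<mu> + E u t) - (Z (s, u) \<mu> + E s u)\<bar>
      \<le> C * (\<bar>u - s\<bar> + \<bar>t - u\<bar>) powr z" if "s \<in> I" "u \<in> I" "t \<in> I" for s u t
    using Z[OF that] E[OF that] by (simp add: Nop_def component_def algebra_simps)
  have "\<exists>g. \<forall>s\<in>I. \<forall>t\<in>I.
      \<bar>Z (s, t) \<mu> + E s t - (g t - g s)\<bar> \<le> (2 / (1 - 2 powr (1 - z)) + 2 powr z) * C * \<bar>t - s\<bar> powr z"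
    by (rule sewing[OF z C HE])
  then obtain g where g: "\<forall>s\<in>I. \<forall>t\<in>I.
      \<bar>Z (s, t) \<mu> + E s t - (g t - g s)\<bar> \<le> (2 / (1 - 2 powr (1 - z)) + 2 powr z) * C * \<bar>t - s\<bar> powr z"
    by (elim exE) (rule that)
  show ?thesis
  proof (intro exI[of _ "\<lambda>(s, t). g t - g s - E s t"] conjI ballI)
    fix s u t assume "s \<in> I" "u \<in> I" "t \<in> I"
    from E[OF this] show "Nop (\<lambda>(s, t). g t - g s - E s t) (s, u, t) = splitting_sum W \<mu> (s, u, t)"
      by (simp add: Nop_def)
  next
    fix s t assume "s \<in> I" "t \<in> I"
    from g[rule_format, OF this] show "\<bar>Z (s, t) \<mu> - (case (s, t) of (s, t) \<Rightarrow> g t - g s - E s t)\<bar>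
        \<le> (2 / (1 - 2 powr (1 - z)) + 2 powr z) * C * \<bar>t - s\<bar> powr z"
      by (simp add: algebra_simps)
  qed
qed simp

lemma splitting_sum_cong:
  assumes "\<And>\<nu> x. length \<nu> < length \<mu> \<Longrightarrow> Z x \<nu> = W x \<nu>"
  shows "splitting_sum Z \<mu> = splitting_sum W \<mu>"
proof
  fix x :: "real \<times> real \<times> real"
  obtain s u t where x: "x = (s, u, t)" by (cases x) auto
  show "splitting_sum Z \<mu> x = splitting_sum W \<mu> x"
    unfolding x splitting_sum_take_drop by (intro sum.cong refl arg_cong2[where f = "(*)"] assms) auto
qed

lemma take_drop_multi_indices:
  assumes "\<mu> \<in> multi_indices B n" "0 < i" "i < length \<mu>"
  shows "take i \<mu> \<in> multi_indices B (length \<mu> - 1)" "drop i \<mu> \<in> multi_indices B (length \<mu> - 1)"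
    "take i \<mu> \<noteq> []" "drop i \<mu> \<noteq> []"
  using assms set_take_subset[of i \<mu>] set_drop_subset[of i \<mu>] by (auto simp: multi_indices_def)

text \<open>
  Induction on the degree.  The invariant carries one constant \<open>K\<close> for all multi-indices, since the
  next degree needs uniform bounds on all lower coefficients; it can be kept uniform because the
  constant of the sewing lemma is explicit.
\<close>
lemma multiplicative_approximation:
  assumes z: "1 < z" and C: "0 \<le> C" and M: "0 \<le> M"
    and L: "\<And>s t. \<lbrakk>s \<in> I; t \<in> I\<rbrakk> \<Longrightarrow> \<bar>t - s\<bar> \<le> L"
    and Z0: "\<And>s t. \<lbrakk>s \<in> I; t \<in> I\<rbrakk> \<Longrightarrow> Z (s, t) [] = 1"
    and Z: "\<And>\<mu> s u t. \<lbrakk>\<mu> \<in> multi_indices B n; \<mu> \<noteq> []; s \<in> I; u \<in> I; t \<in> I\<rbrakk> \<Longrightarrow>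
      \<bar>Nop (component Z \<mu>) (s, u, t) - splitting_sum Z \<mu> (s, u, t)\<bar> \<le> C * (\<bar>u - s\<bar> + \<bar>t - u\<bar>) powr z"
    and ZM: "\<And>\<mu> s t. \<lbrakk>\<mu> \<in> multi_indices B n; s \<in> I; t \<in> I\<rbrakk> \<Longrightarrow> \<bar>Z (s, t) \<mu>\<bar> \<le> M"
    and "k \<le> n"
  shows "\<exists>W. (\<forall>s\<in>I. \<forall>t\<in>I. W (s, t) [] = 1) \<and>
    (\<forall>\<mu>\<in>multi_indices B k. \<mu> \<noteq> [] \<longrightarrow> (\<forall>s\<in>I. \<forall>u\<in>I. \<forall>t\<in>I.
       Nop (component W \<mu>) (s, u, t) = splitting_sum W \<mu> (s, u, t))) \<and>
    (\<exists>K\<ge>0. \<forall>\<mu>\<in>multi_indices B k. \<forall>s\<in>I. \<forall>t\<in>I. \<bar>Z (s, t) \<mu> - W (s, t) \<mu>\<bar> \<le> K * \<bar>t - s\<bar> powr z)"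
  using \<open>k \<le> n\<close>
proof (induction k)
  case 0
  show ?case
    by (intro exI[of _ Z] conjI exI[of _ 0]) (simp_all add: Z0 multi_indices_def)
next
  case (Suc k)
  then have "k \<le> n" by simp
  from Suc.IH[OF this] obtain W K where W0: "\<forall>s\<in>I. \<forall>t\<in>I. W (s, t) [] = 1"
    and W: "\<forall>\<mu>\<in>multi_indices B k. \<mu> \<noteq> [] \<longrightarrow> (\<forall>s\<in>I. \<forall>u\<in>I. \<forall>t\<in>I.
       Nop (component W \<mu>) (s, u, t) = splitting_sum W \<mu> (s, u, t))"
    and K: "0 \<le> K"
    and WK: "\<forall>\<mu>\<in>multi_indices B k. \<forall>s\<in>I. \<forall>t\<in>I.
       \<bar>Z (s, t) \<mu> - W (s, t) \<mu>\<bar> \<le> K * \<bar>t - s\<bar> powr z"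
    by (elim exE conjE) (rule that)
  note W0 = W0[rule_format] and W = W[rule_format] and WK = WK[rule_format]
  \<comment> \<open>The lower coefficients of \<open>W\<close> are bounded because they are close to those of \<open>Z\<close>.\<close>
  define M' where "M' = M + K * L powr z"
  have M': "M \<le> M'" "0 \<le> M'" using M K by (auto simp: M'_def)
  have WM: "\<bar>W (s, t) \<mu>\<bar> \<le> M'" if "\<mu> \<in> multi_indices B k" "s \<in> I" "t \<in> I" for \<mu> s t
  proof -
    have "K * \<bar>t - s\<bar> powr z \<le> K * L powr z"
      using K z L[OF that(2,3)] by (intro mult_left_mono powr_mono2) auto
    moreover have "\<mu> \<in> multi_indices B n" using that(1) Suc.prems by (auto simp: multi_indices_def)
    ultimately show ?thesis using WK[OF that] ZM[of \<mu> s t] that by (simp add: M'_def)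
  qed
  define C' where "C' = C + real (Suc k) * (2 * K * M')"
  have C': "0 \<le> C'" using C K M' by (simp add: C'_def)
  define K' where "K' = (2 / (1 - 2 powr (1 - z)) + 2 powr z) * C'"
  let ?top = "{\<mu>. set \<mu> \<subseteq> B \<and> length \<mu> = Suc k}"
  have "\<forall>\<mu>\<in>?top. \<exists>f. (\<forall>s\<in>I. \<forall>u\<in>I. \<forall>t\<in>I. Nop f (s, u, t) = splitting_sum W \<mu> (s, u, t)) \<and>
             (\<forall>s\<in>I. \<forall>t\<in>I. \<bar>Z (s, t) \<mu> - f (s, t)\<bar> \<le> K' * \<bar>t - s\<bar> powr z)"
  proof
    fix \<mu> assume "\<mu> \<in> ?top"
    then have \<mu>: "\<mu> \<in> multi_indices B n" "length \<mu> = Suc k" "\<mu> \<noteq> []"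
      using Suc.prems by (auto simp: multi_indices_def)
    have sub: "take i \<mu> \<in> multi_indices B k" "drop i \<mu> \<in> multi_indices B k" "take i \<mu> \<noteq> []" "drop i \<mu> \<noteq> []"
      "drop i \<mu> \<in> multi_indices B n"
      if "0 < i" "i < length \<mu>" for i
      using take_drop_multi_indices[OF \<mu>(1) that] \<mu>(2) Suc.prems by (auto simp: multi_indices_def)
    have Wtake: "Nop (component W (take i \<mu>)) (s, u, t) = splitting_sum W (take i \<mu>) (s, u, t)"
      and Wdrop: "Nop (component W (drop i \<mu>)) (s, u, t) = splitting_sum W (drop i \<mu>) (s, u, t)"
      if "0 < i" "i < length \<mu>" "s \<in> I" "u \<in> I" "t \<in> I" for i s u t
      by (rule W[OF sub(1,3)[OF that(1,2)] that(3-5)], rule W[OF sub(2,4)[OF that(1,2)] that(3-5)])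
    have diff: "\<bar>Z (s, t) (take i \<mu>) - W (s, t) (take i \<mu>)\<bar> \<le> K * \<bar>t - s\<bar> powr z \<and>
        \<bar>Z (s, t) (drop i \<mu>) - W (s, t) (drop i \<mu>)\<bar> \<le> K * \<bar>t - s\<bar> powr z"
      and bounded: "\<bar>W (s, t) (take i \<mu>)\<bar> \<le> M' \<and> \<bar>Z (s, t) (drop i \<mu>)\<bar> \<le> M'"
      if "0 < i" "i < length \<mu>" "s \<in> I" "t \<in> I" for i s t
      using WK[OF sub(1)[OF that(1,2)] that(3,4)] WK[OF sub(2)[OF that(1,2)] that(3,4)]
        WM[OF sub(1)[OF that(1,2)] that(3,4)] order_trans[OF ZM[OF sub(5)[OF that(1,2)] that(3,4)] M'(1)]
      by blast+
    have defect: "\<bar>Nop (component Z \<mu>) (s, u, t) - splitting_sum W \<mu> (s, u, t)\<bar> \<le> C' * (\<bar>u - s\<bar> + \<bar>t - u\<bar>) powr z"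
      if I: "s \<in> I" "u \<in> I" "t \<in> I" for s u t
    proof -
      have "\<bar>splitting_sum Z \<mu> (s, u, t) - splitting_sum W \<mu> (s, u, t)\<bar>
          \<le> real (length \<mu>) * (2 * K * M') * (\<bar>u - s\<bar> + \<bar>t - u\<bar>) powr z"
        by (rule splitting_sum_diff_bound[where I = I, OF K M'(2) _ diff bounded I]) (use z in simp)
      with Z[OF \<mu>(1,3) I] show ?thesis
        unfolding C'_def distrib_right \<mu>(2) by linarith
    qed
    show "\<exists>f. (\<forall>s\<in>I. \<forall>u\<in>I. \<forall>t\<in>I. Nop f (s, u, t) = splitting_sum W \<mu> (s, u, t)) \<and>
             (\<forall>s\<in>I. \<forall>t\<in>I. \<bar>Z (s, t) \<mu> - f (s, t)\<bar> \<le> K' * \<bar>t - s\<bar> powr z)"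
      unfolding K'_def by (rule multiplicative_lift[OF z C' Wtake Wdrop defect])
  qed
  from bchoice[OF this] obtain f where
    f: "\<And>\<mu> s u t. \<lbrakk>\<mu> \<in> ?top; s \<in> I; u \<in> I; t \<in> I\<rbrakk> \<Longrightarrow> Nop (f \<mu>) (s, u, t) = splitting_sum W \<mu> (s, u, t)"
    and fK: "\<And>\<mu> s t. \<lbrakk>\<mu> \<in> ?top; s \<in> I; t \<in> I\<rbrakk> \<Longrightarrow> \<bar>Z (s, t) \<mu> - f \<mu> (s, t)\<bar> \<le> K' * \<bar>t - s\<bar> powr z"
    by blast
  define W' where "W' x \<mu> = (if length \<mu> \<le> k then W x \<mu> else f \<mu> x)" for x \<mu>
  have split: "splitting_sum W' \<mu> = splitting_sum W \<mu>" if "\<mu> \<in> multi_indices B (Suc k)" for \<mu>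
    using that by (intro splitting_sum_cong) (auto simp: W'_def multi_indices_def)
  have cases: "\<mu> \<in> multi_indices B k \<or> \<mu> \<in> ?top" if "\<mu> \<in> multi_indices B (Suc k)" for \<mu>
    using that by (auto simp: multi_indices_def)
  have low: "component W' \<mu> = component W \<mu>" if "\<mu> \<in> multi_indices B k" for \<mu>
    using that by (auto simp: component_def W'_def multi_indices_def)
  have top: "component W' \<mu> = f \<mu>" if "\<mu> \<in> ?top" for \<mu>
    using that by (auto simp: component_def W'_def)
  show ?case
  proof (intro exI[of _ W'] conjI ballI impI exI[of _ "max K K'"])
    show "W' (s, t) [] = 1" if "s \<in> I" "t \<in> I" for s t
      using W0[OF that] by (simp add: W'_def)
  next
    fix \<mu> s u t assume \<mu>: "\<mu> \<in> multi_indices B (Suc k)" "\<mu> \<noteq> []" and I: "s \<in> I" "u \<in> I" "t \<in> I"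
    show "Nop (component W' \<mu>) (s, u, t) = splitting_sum W' \<mu> (s, u, t)"
      using cases[OF \<mu>(1)]
    proof
      assume a: "\<mu> \<in> multi_indices B k"
      show ?thesis using W[OF a \<mu>(2) I] unfolding split[OF \<mu>(1)] low[OF a] .
    next
      assume a: "\<mu> \<in> ?top"
      show ?thesis using f[OF a I] unfolding split[OF \<mu>(1)] top[OF a] .
    qed
  next
    show "0 \<le> max K K'" using K by simp
  next
    fix \<mu> s t assume \<mu>: "\<mu> \<in> multi_indices B (Suc k)" and I: "s \<in> I" "t \<in> I"
    have "K * \<bar>t - s\<bar> powr z \<le> max K K' * \<bar>t - s\<bar> powr z" "K' * \<bar>t - s\<bar> powr z \<le> max K K' * \<bar>t - s\<bar> powr z"
      by (auto intro: mult_right_mono)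
    moreover have "\<bar>Z (s, t) \<mu> - W' (s, t) \<mu>\<bar> \<le> K * \<bar>t - s\<bar> powr z \<or> \<bar>Z (s, t) \<mu> - W' (s, t) \<mu>\<bar> \<le> K' * \<bar>t - s\<bar> powr z"
      using cases[OF \<mu>] WK[OF _ I] fK[OF _ I] by (auto simp: W'_def multi_indices_def)
    ultimately show "\<bar>Z (s, t) \<mu> - W' (s, t) \<mu>\<bar> \<le> max K K' * \<bar>t - s\<bar> powr z"
      by linarith
  qed
qed

section \<open>Bounds for almost multiplicative paths\<close>

lemma finite_multi_indices: "finite B \<Longrightarrow> finite (multi_indices B n)"
  unfolding multi_indices_def by (rule finite_lists_length_le)

lemma uniform_constant:
  fixes f :: "'a \<Rightarrow> 'b \<Rightarrow> real"
  assumes "finite A" and g: "\<And>x. x \<in> X \<Longrightarrow> 0 \<le> g x"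
    and ex: "\<And>a. a \<in> A \<Longrightarrow> \<exists>c\<ge>0. \<forall>x\<in>X. f a x \<le> c * g x"
  shows "\<exists>c\<ge>0. \<forall>a\<in>A. \<forall>x\<in>X. f a x \<le> c * g x"
proof -
  from bchoice[of A "\<lambda>a c. 0 \<le> c \<and> (\<forall>x\<in>X. f a x \<le> c * g x)"] ex
  obtain c where c: "\<And>a. a \<in> A \<Longrightarrow> 0 \<le> c a" "\<And>a x. \<lbrakk>a \<in> A; x \<in> X\<rbrakk> \<Longrightarrow> f a x \<le> c a * g x"
    by blast
  have "f a x \<le> sum c A * g x" if "a \<in> A" "x \<in> X" for a x
  proof -
    have "c a \<le> sum c A" using that c(1) assms(1) by (intro member_le_sum) auto
    then show ?thesis using c(2)[OF that] g[OF that(2)] by (meson mult_right_mono order_trans)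
  qed
  moreover have "0 \<le> sum c A" using c(1) by (rule sum_nonneg)
  ultimately show ?thesis by blast
qed

text \<open>
  The Hoelder norms say nothing about the diagonal.  There \<open>N Z\<close> is \<open>- Z (s, s)\<close>, while the
  splitting sum consists of products of lower coefficients that vanish by induction.
\<close>
lemma component_diagonal_eq_0:
  assumes Z: "\<And>\<mu>. \<lbrakk>\<mu> \<in> multi_indices B n; \<mu> \<noteq> []\<rbrakk> \<Longrightarrow>
      Nop (component Z \<mu>) (s, s, s) = splitting_sum Z \<mu> (s, s, s)"
    and "\<mu> \<in> multi_indices B n" "\<mu> \<noteq> []"
  shows "Z (s, s) \<mu> = 0"
  using assms(2,3)
proof (induction \<mu> rule: length_induct)
  case (1 \<mu>)
  have "Z (s, s) (take i \<mu>) = 0" if "0 < i" "i < length \<mu>" for i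
  proof -
    have "take i \<mu> \<in> multi_indices B n" "take i \<mu> \<noteq> []"
      using take_drop_multi_indices[OF 1(2) that] 1(2) by (auto simp: multi_indices_def)
    with 1(1) that show ?thesis by simp
  qed
  then have "splitting_sum Z \<mu> (s, s, s) = 0"
    unfolding splitting_sum_take_drop by (intro sum.neutral) auto
  with Z[OF 1(2,3)] show ?case by (simp add: Nop_def component_def)
qed

lemma almost_multiplicative_path_diagonal:
  assumes "almost_multiplicative_path I B p n Z" "s \<in> I" "\<mu> \<in> multi_indices B n" "\<mu> \<noteq> []"
  shows "Z (s, s) \<mu> = 0"
proof (rule component_diagonal_eq_0[OF _ assms(3,4)])
  fix \<mu> assume \<mu>: "\<mu> \<in> multi_indices B n" "\<mu> \<noteq> []"
  obtain z R where R: "R \<in> OmegaC2 I z"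
    "\<And>x. x \<in> I \<times> I \<times> I \<Longrightarrow> Nop (component Z \<mu>) x = splitting_sum Z \<mu> x + R x"
    using assms(1) \<mu> unfolding almost_multiplicative_path_def by metis
  moreover have "R (s, s, s) = 0"
    using R(1) assms(2) unfolding OmegaC2_def by (auto intro!: sum.neutral)
  ultimately show "Nop (component Z \<mu>) (s, s, s) = splitting_sum Z \<mu> (s, s, s)"
    using assms(2) by simp
qed

text \<open>
  The norms on the remainder only control triples with \<open>s \<noteq> u\<close> and \<open>u \<noteq> t\<close>.  On the other triples
  the defect is zero, since \<open>Z\<close> vanishes on the diagonal.
\<close>
lemma almost_multiplicative_path_defect:
  assumes "finite B" and Z: "almost_multiplicative_path I B p n Z"
  obtains z C where "1 < z" "0 \<le> C"
    "\<And>\<mu> s u t. \<lbrakk>\<mu> \<in> multi_indices B n; \<mu> \<noteq> []; s \<in> I; u \<in> I; t \<in> I\<rbrakk> \<Longrightarrow>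
      \<bar>Nop (component Z \<mu>) (s, u, t) - splitting_sum Z \<mu> (s, u, t)\<bar> \<le> C * (\<bar>u - s\<bar> + \<bar>t - u\<bar>) powr z"
proof -
  obtain z where z: "1 < z" and R: "\<And>\<mu>. \<lbrakk>\<mu> \<in> multi_indices B n; \<mu> \<noteq> []\<rbrakk> \<Longrightarrow>
      \<exists>R\<in>OmegaC2 I z. \<forall>x\<in>I \<times> I \<times> I. Nop (component Z \<mu>) x = splitting_sum Z \<mu> x + R x"
    using Z unfolding almost_multiplicative_path_def by blast
  define f where "f \<mu> = (\<lambda>(s, u, t). \<bar>Nop (component Z \<mu>) (s, u, t) - splitting_sum Z \<mu> (s, u, t)\<bar>)" for \<mu>
  define g :: "real \<times> real \<times> real \<Rightarrow> real" where "g = (\<lambda>(s, u, t). (\<bar>u - s\<bar> + \<bar>t - u\<bar>) powr z)"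
  have "\<exists>c\<ge>0. \<forall>\<mu>\<in>multi_indices B n - {[]}. \<forall>x\<in>I \<times> I \<times> I. f \<mu> x \<le> c * g x"
  proof (rule uniform_constant)
    show "finite (multi_indices B n - {[]})" using assms(1) by (simp add: finite_multi_indices)
    show "0 \<le> g x" for x by (simp add: g_def split_def)
  next
    fix \<mu> assume "\<mu> \<in> multi_indices B n - {[]}"
    then have \<mu>: "\<mu> \<in> multi_indices B n" "\<mu> \<noteq> []" by auto
    obtain R where R: "R \<in> OmegaC2 I z" "\<And>x. x \<in> I \<times> I \<times> I \<Longrightarrow> Nop (component Z \<mu>) x = splitting_sum Z \<mu> x + R x"
      using R[OF \<mu>] by blast
    obtain C where C: "0 \<le> C" "\<And>s u t. \<lbrakk>s \<in> I; u \<in> I; t \<in> I; s \<noteq> u; u \<noteq> t\<rbrakk> \<Longrightarrow>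
       \<bar>R (s, u, t)\<bar> \<le> C * (\<bar>u - s\<bar> + \<bar>t - u\<bar>) powr z"
      by (rule OmegaC2_bound[OF R(1)]) blast
    have "f \<mu> (s, u, t) \<le> C * g (s, u, t)" if I: "s \<in> I" "u \<in> I" "t \<in> I" for s u t
    proof (cases "s = u \<or> u = t")
      case False
      then show ?thesis using C(2)[OF I] R(2)[of "(s, u, t)"] I by (simp add: f_def g_def)
    next
      case True
      have diag: "Z (v, v) \<nu> = 0" if "v \<in> I" "\<nu> \<in> multi_indices B n" "\<nu> \<noteq> []" for v \<nu>
        using almost_multiplicative_path_diagonal[OF Z that] .
      have sub: "take i \<mu> \<in> multi_indices B n" "drop i \<mu> \<in> multi_indices B n" "take i \<mu> \<noteq> []" "drop i \<mu> \<noteq> []"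
        if "0 < i" "i < length \<mu>" for i
        using take_drop_multi_indices[OF \<mu>(1) that] \<mu>(1) by (auto simp: multi_indices_def)
      have "splitting_sum Z \<mu> (s, u, t) = 0"
        unfolding splitting_sum_take_drop
        using True diag[OF I(2)] sub by (intro sum.neutral) (auto simp: Suc_le_eq)
      moreover have "Nop (component Z \<mu>) (s, u, t) = 0"
        using True diag[OF I(2) \<mu>] by (auto simp: Nop_def component_def)
      ultimately show ?thesis using C(1) by (simp add: f_def g_def)
    qed
    with C(1) show "\<exists>c\<ge>0. \<forall>x\<in>I \<times> I \<times> I. f \<mu> x \<le> c * g x" by auto
  qed
  then obtain C where "0 \<le> C" "\<And>\<mu> x. \<lbrakk>\<mu> \<in> multi_indices B n; \<mu> \<noteq> []; x \<in> I \<times> I \<times> I\<rbrakk> \<Longrightarrow> f \<mu> x \<le> C * g x"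
    by blast
  with z show ?thesis by (intro that[of z C]) (auto simp: f_def g_def)
qed

lemma finite_p_variation_bounded:
  assumes "finite B" "bounded I" "0 < p" and Z: "finite_p_variation I B p n Z"
    and diag: "\<And>s \<mu>. \<lbrakk>s \<in> I; \<mu> \<in> multi_indices B n\<rbrakk> \<Longrightarrow> \<bar>Z (s, s) \<mu>\<bar> \<le> 1"
  obtains M where "0 \<le> M" "\<And>\<mu> s t. \<lbrakk>\<mu> \<in> multi_indices B n; s \<in> I; t \<in> I\<rbrakk> \<Longrightarrow> \<bar>Z (s, t) \<mu>\<bar> \<le> M"
proof -
  obtain K where K: "0 < K" and Z: "\<And>\<mu>. \<mu> \<in> multi_indices B n \<Longrightarrow>
      hoelder_norm I (real (length \<mu>) / p) (component Z \<mu>) \<le> ennreal (K ^ length \<mu>)"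
    using Z unfolding finite_p_variation_def by blast
  have "\<exists>c\<ge>0. \<forall>\<mu>\<in>multi_indices B n. \<forall>x\<in>I \<times> I. \<bar>Z x \<mu>\<bar> \<le> c * 1"
  proof (rule uniform_constant)
    show "finite (multi_indices B n)" using assms(1) by (rule finite_multi_indices)
  next
    fix \<mu> assume \<mu>: "\<mu> \<in> multi_indices B n"
    define c where "c = max 1 (K ^ length \<mu> * diameter I powr (real (length \<mu>) / p))"
    have "\<bar>Z (s, t) \<mu>\<bar> \<le> c" if I: "s \<in> I" "t \<in> I" for s t
    proof (cases "s = t")
      case True
      then show ?thesis using diag[OF I(1) \<mu>] by (simp add: c_def)
    next
      case False
      have "\<bar>Z (s, t) \<mu>\<bar> \<le> K ^ length \<mu> * \<bar>t - s\<bar> powr (real (length \<mu>) / p)"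
        using Z[OF \<mu>] K I False by (simp add: hoelder_norm_le_iff component_def)
      also have "\<dots> \<le> K ^ length \<mu> * diameter I powr (real (length \<mu>) / p)"
        using K \<open>0 < p\<close> diameter_bounded_bound[OF \<open>bounded I\<close> I]
        by (intro mult_left_mono powr_mono2) (auto simp: dist_real_def abs_minus_commute)
      finally show ?thesis by (simp add: c_def)
    qed
    then show "\<exists>c\<ge>0. \<forall>x\<in>I \<times> I. \<bar>Z x \<mu>\<bar> \<le> c * 1"
      by (intro exI[of _ c]) (auto simp: c_def)
  qed simp
  then show ?thesis using that by auto
qed

text \<open>
  A constant for each multi-index suffices: a common bound \<open>K \<ge> 1\<close> satisfies \<open>K \<le> K ^ length \<mu>\<close> in
  positive degree.  In degree \<open>0\<close> the power is \<open>1\<close>, whence the separate assumption on \<open>Z (s, t) []\<close>.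
\<close>
lemma finite_p_variationI:
  assumes "finite B"
    and empty: "\<And>s t. \<lbrakk>s \<in> I; t \<in> I\<rbrakk> \<Longrightarrow> \<bar>Z (s, t) []\<bar> \<le> 1"
    and Z: "\<And>\<mu>. \<mu> \<in> multi_indices B n \<Longrightarrow>
       \<exists>c\<ge>0. \<forall>s\<in>I. \<forall>t\<in>I. s \<noteq> t \<longrightarrow> \<bar>Z (s, t) \<mu>\<bar> \<le> c * \<bar>t - s\<bar> powr (real (length \<mu>) / p)"
  shows "finite_p_variation I B p n Z"
proof -
  from bchoice[of "multi_indices B n" "\<lambda>\<mu> c. 0 \<le> c \<and> (\<forall>s\<in>I. \<forall>t\<in>I. s \<noteq> t \<longrightarrow>
      \<bar>Z (s, t) \<mu>\<bar> \<le> c * \<bar>t - s\<bar> powr (real (length \<mu>) / p))"] Z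
  obtain c where c: "\<And>\<mu>. \<mu> \<in> multi_indices B n \<Longrightarrow> 0 \<le> c \<mu>"
    "\<And>\<mu> s t. \<lbrakk>\<mu> \<in> multi_indices B n; s \<in> I; t \<in> I; s \<noteq> t\<rbrakk> \<Longrightarrow>
       \<bar>Z (s, t) \<mu>\<bar> \<le> c \<mu> * \<bar>t - s\<bar> powr (real (length \<mu>) / p)"
    by blast
  define K where "K = 1 + sum c (multi_indices B n)"
  have K: "1 \<le> K" using c(1) by (simp add: K_def sum_nonneg)
  have "\<bar>Z (s, t) \<mu>\<bar> \<le> K ^ length \<mu> * \<bar>t - s\<bar> powr (real (length \<mu>) / p)"
    if \<mu>: "\<mu> \<in> multi_indices B n" and st: "s \<in> I" "t \<in> I" "s \<noteq> t" for \<mu> s t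
  proof (cases "\<mu> = []")
    case True
    then show ?thesis using empty[OF st(1,2)] st(3) by simp
  next
    case False
    have "c \<mu> \<le> sum c (multi_indices B n)"
      using \<mu> c(1) finite_multi_indices[OF assms(1)] by (intro member_le_sum) auto
    also have "\<dots> \<le> K" by (simp add: K_def)
    also have "\<dots> \<le> K ^ length \<mu>" using K False by (intro self_le_power) auto
    finally show ?thesis using c(2)[OF \<mu> st] by (meson mult_right_mono order_trans powr_ge_zero)
  qed
  then show ?thesis
    unfolding finite_p_variation_def using K
    by (intro exI[of _ K]) (auto simp: hoelder_norm_le_iff component_def)
qed

section \<open>Uniqueness\<close>

lemma multiplicative_path_eqI:
  assumes "is_interval I"
    and Z1: "multiplicative_path I B n Z1" and Z2: "multiplicative_path I B n Z2"
    and z: "1 < z" "1 < z'"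
    and diff: "\<And>\<mu> s t. \<lbrakk>\<mu> \<in> multi_indices B n; s \<in> I; t \<in> I; s \<noteq> t\<rbrakk> \<Longrightarrow>
      \<bar>Z1 (s, t) \<mu> - Z2 (s, t) \<mu>\<bar> \<le> K * \<bar>t - s\<bar> powr z + K' * \<bar>t - s\<bar> powr z'"
  shows "Z1 = Z2"
proof -
  have eq: "Z1 (s, t) \<mu> = Z2 (s, t) \<mu>" if "\<mu> \<in> multi_indices B n" "s \<in> I" "t \<in> I" for \<mu> s t
    using that
  proof (induction \<mu> arbitrary: s t rule: length_induct)
    case (1 \<mu>)
    show ?case
    proof (cases "\<mu> = []")
      case True
      then show ?thesis using Z1 Z2 1 by (simp add: multiplicative_path_def component_def)
    next
      case False
      define D where "D s t = Z1 (s, t) \<mu> - Z2 (s, t) \<mu>" for s t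
      have add: "D s t = D s u + D u t" if I: "s \<in> I" "u \<in> I" "t \<in> I" for s u t
      proof -
        have lower: "Z1 (v, w) (take i \<mu>) = Z2 (v, w) (take i \<mu>)" "Z1 (v, w) (drop i \<mu>) = Z2 (v, w) (drop i \<mu>)"
          if "0 < i" "i < length \<mu>" "v \<in> I" "w \<in> I" for i v w
          using 1(1) take_drop_multi_indices[OF 1(2) that(1,2)] 1(2) that
          by (auto simp: multi_indices_def)
        have "splitting_sum Z1 \<mu> (s, u, t) = splitting_sum Z2 \<mu> (s, u, t)"
          unfolding splitting_sum_take_drop using I by (intro sum.cong refl) (simp add: lower)
        moreover have "Nop (component Z1 \<mu>) (s, u, t) = splitting_sum Z1 \<mu> (s, u, t)"
          "Nop (component Z2 \<mu>) (s, u, t) = splitting_sum Z2 \<mu> (s, u, t)"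
          using Z1 Z2 1(2) False I unfolding multiplicative_path_def by auto
        ultimately show ?thesis by (simp add: D_def Nop_def component_def)
      qed
      have "D s t = 0"
      proof (rule additive_superlinear_eq_0[OF assms(1) add _ z 1(3,4)])
        show "\<bar>D s t\<bar> \<le> K * \<bar>t - s\<bar> powr z + K' * \<bar>t - s\<bar> powr z'"
          if "s \<in> I" "t \<in> I" "s \<noteq> t" for s t
          using diff[OF 1(2) that] by (simp add: D_def)
      qed
      then show ?thesis by (simp add: D_def)
    qed
  qed
  have paths: "Z1 \<in> I \<times> I \<rightarrow>\<^sub>E trunc_tensors B n" "Z2 \<in> I \<times> I \<rightarrow>\<^sub>E trunc_tensors B n"
    using Z1 Z2 by (auto simp: multiplicative_path_def tensor_paths_def)
  show ?thesis
  proof (rule PiE_ext[OF paths])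
    fix x assume x: "x \<in> I \<times> I"
    then obtain s t where st: "x = (s, t)" "s \<in> I" "t \<in> I" by auto
    have trunc: "Z1 x \<in> trunc_tensors B n" "Z2 x \<in> trunc_tensors B n"
      using paths[THEN PiE_mem, OF x] by auto
    show "Z1 x = Z2 x"
    proof
      fix \<mu> show "Z1 x \<mu> = Z2 x \<mu>"
      proof (cases "\<mu> \<in> multi_indices B n")
        case True
        from eq[OF this st(2,3)] show ?thesis unfolding st(1) .
      next
        case False
        then show ?thesis using trunc by (simp add: trunc_tensors_def)
      qed
    qed
  qed
qed

section \<open>The associated multiplicative path\<close>

lemma component_restrict:
  assumes "\<mu> \<in> multi_indices B n" "x \<in> I \<times> I"
  shows "component (restrict (\<lambda>x \<mu>. if \<mu> \<in> multi_indices B n then W x \<mu> else 0) (I \<times> I)) \<mu> x = W x \<mu>"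
  using assms by (simp add: component_def)

lemma multiplicative_path_restrict:
  assumes W0: "\<And>s t. \<lbrakk>s \<in> I; t \<in> I\<rbrakk> \<Longrightarrow> W (s, t) [] = 1"
    and W: "\<And>\<mu> s u t. \<lbrakk>\<mu> \<in> multi_indices B n; \<mu> \<noteq> []; s \<in> I; u \<in> I; t \<in> I\<rbrakk> \<Longrightarrow>
       Nop (component W \<mu>) (s, u, t) = splitting_sum W \<mu> (s, u, t)"
  shows "multiplicative_path I B n
    (restrict (\<lambda>x \<mu>. if \<mu> \<in> multi_indices B n then W x \<mu> else 0) (I \<times> I))" (is "multiplicative_path I B n ?Zt")
  unfolding multiplicative_path_def
proof (intro conjI ballI impI)
  show "?Zt \<in> tensor_paths I B n" by (auto simp: tensor_paths_def trunc_tensors_def)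
next
  fix x assume "x \<in> I \<times> I"
  moreover have "[] \<in> multi_indices B n" by (simp add: multi_indices_def)
  ultimately show "component ?Zt [] x = 1" using W0 by (auto simp: component_restrict)
next
  fix \<mu> x assume \<mu>: "\<mu> \<in> multi_indices B n" "\<mu> \<noteq> []" and "x \<in> I \<times> I \<times> I"
  then obtain s u t where x: "x = (s, u, t)" and I: "s \<in> I" "u \<in> I" "t \<in> I" by auto
  have "take i \<mu> \<in> multi_indices B n" "drop i \<mu> \<in> multi_indices B n" if "0 < i" "i < length \<mu>" for i
    using take_drop_multi_indices[OF \<mu>(1) that] \<mu>(1) by (auto simp: multi_indices_def)
  then have "splitting_sum ?Zt \<mu> x = splitting_sum W \<mu> x"
    unfolding x splitting_sum_take_drop using I by (intro sum.cong refl) simp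
  moreover have "Nop (component ?Zt \<mu>) x = Nop (component W \<mu>) x"
    using \<mu> I by (simp add: x Nop_def component_def)
  ultimately show "Nop (component ?Zt \<mu>) x = splitting_sum ?Zt \<mu> x"
    using W[OF \<mu> I] x by simp
qed

theorem proposition9:
  fixes I :: "real set"
    and B :: "'v::real_vector set"
    and p :: real and n :: nat
    and Z :: "real \<times> real \<Rightarrow> 'v list \<Rightarrow> real"
  assumes "finite B" and "independent B" and "span B = (UNIV :: 'v set)"
    and "is_interval I" and "bounded I"
    and "0 < p"
    and "\<lfloor>p\<rfloor> \<le> int n"
    and "finite_p_variation I B p n Z"
    and "almost_multiplicative_path I B p n Z"
  shows "\<exists>!Zt. multiplicative_path I B (nat \<lfloor>p\<rfloor>) Zt \<and>
           finite_p_variation I B p (nat \<lfloor>p\<rfloor>) Zt \<and>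
           (\<exists>z>1. \<exists>K>0. \<forall>\<mu> \<in> multi_indices B (nat \<lfloor>p\<rfloor>).
              hoelder_norm I z (\<lambda>x. component Z \<mu> x - component Zt \<mu> x) \<le> ennreal K)"
proof -
  define N where "N = nat \<lfloor>p\<rfloor>"
  have N: "N \<le> n" "real N \<le> p"
    using assms(6,7) by (auto simp: N_def of_nat_nat)
  have sub: "\<mu> \<in> multi_indices B n" if "\<mu> \<in> multi_indices B N" for \<mu>
    using that N(1) by (auto simp: multi_indices_def)
  have L: "\<bar>t - s\<bar> \<le> diameter I" if "s \<in> I" "t \<in> I" for s t
    using diameter_bounded_bound[OF \<open>bounded I\<close> that] by (simp add: dist_real_def abs_minus_commute)
  have Z0: "Z (s, t) [] = 1" if "s \<in> I" "t \<in> I" for s t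
    using assms(9) that by (simp add: almost_multiplicative_path_def component_def)
  obtain z C where z: "1 < z" and C: "0 \<le> C" and defect:
    "\<And>\<mu> s u t. \<lbrakk>\<mu> \<in> multi_indices B n; \<mu> \<noteq> []; s \<in> I; u \<in> I; t \<in> I\<rbrakk> \<Longrightarrow>
      \<bar>Nop (component Z \<mu>) (s, u, t) - splitting_sum Z \<mu> (s, u, t)\<bar> \<le> C * (\<bar>u - s\<bar> + \<bar>t - u\<bar>) powr z"
    by (rule almost_multiplicative_path_defect[OF assms(1,9)]) blast
  have diag: "\<bar>Z (s, s) \<mu>\<bar> \<le> 1" if "s \<in> I" "\<mu> \<in> multi_indices B n" for s \<mu>
    using Z0[OF that(1,1)] almost_multiplicative_path_diagonal[OF assms(9) that] by (cases "\<mu> = []") auto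
  obtain M where M: "0 \<le> M" "\<And>\<mu> s t. \<lbrakk>\<mu> \<in> multi_indices B n; s \<in> I; t \<in> I\<rbrakk> \<Longrightarrow> \<bar>Z (s, t) \<mu>\<bar> \<le> M"
    by (rule finite_p_variation_bounded[OF assms(1,5,6,8) diag]) (assumption+, blast)
  have "\<exists>W. (\<forall>s\<in>I. \<forall>t\<in>I. W (s, t) [] = 1) \<and>
    (\<forall>\<mu>\<in>multi_indices B N. \<mu> \<noteq> [] \<longrightarrow> (\<forall>s\<in>I. \<forall>u\<in>I. \<forall>t\<in>I.
       Nop (component W \<mu>) (s, u, t) = splitting_sum W \<mu> (s, u, t))) \<and>
    (\<exists>K\<ge>0. \<forall>\<mu>\<in>multi_indices B N. \<forall>s\<in>I. \<forall>t\<in>I. \<bar>Z (s, t) \<mu> - W (s, t) \<mu>\<bar> \<le> K * \<bar>t - s\<bar> powr z)"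
    by (rule multiplicative_approximation[OF z C M(1) L Z0 defect M(2) N(1)])
  then obtain W K where W0: "\<forall>s\<in>I. \<forall>t\<in>I. W (s, t) [] = 1"
    and W: "\<forall>\<mu>\<in>multi_indices B N. \<mu> \<noteq> [] \<longrightarrow> (\<forall>s\<in>I. \<forall>u\<in>I. \<forall>t\<in>I.
       Nop (component W \<mu>) (s, u, t) = splitting_sum W \<mu> (s, u, t))"
    and K: "0 \<le> K"
    and WK: "\<forall>\<mu>\<in>multi_indices B N. \<forall>s\<in>I. \<forall>t\<in>I.
       \<bar>Z (s, t) \<mu> - W (s, t) \<mu>\<bar> \<le> K * \<bar>t - s\<bar> powr z"
    by (elim exE conjE) (rule that)
  note W0 = W0[rule_format] and W = W[rule_format] and WK = WK[rule_format]
  define Zt where "Zt = restrict (\<lambda>x \<mu>. if \<mu> \<in> multi_indices B N then W x \<mu> else 0) (I \<times> I)"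
  have Zt: "Zt (s, t) \<mu> = W (s, t) \<mu>" if "\<mu> \<in> multi_indices B N" "s \<in> I" "t \<in> I" for \<mu> s t
    using that by (simp add: Zt_def)
  have mult: "multiplicative_path I B N Zt"
    unfolding Zt_def by (rule multiplicative_path_restrict) (fact W0 W)+
  have var: "finite_p_variation I B p N Zt"
  proof (rule finite_p_variationI[OF assms(1)])
    fix s t assume "s \<in> I" "t \<in> I"
    then show "\<bar>Zt (s, t) []\<bar> \<le> 1" using Zt[of "[]" s t] W0 by (simp add: multi_indices_def)
  next
    fix \<mu> assume \<mu>: "\<mu> \<in> multi_indices B N"
    define a where "a = real (length \<mu>) / p"
    have "real (length \<mu>) \<le> p" using \<mu> N(2) by (simp add: multi_indices_def)
    then have "a \<le> 1" using assms(6) by (simp add: a_def)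
    then have a: "a \<le> z" using z by simp
    obtain k where k: "0 < k" and Zk: "\<And>\<mu>. \<mu> \<in> multi_indices B n \<Longrightarrow>
        hoelder_norm I (real (length \<mu>) / p) (component Z \<mu>) \<le> ennreal (k ^ length \<mu>)"
      using assms(8) unfolding finite_p_variation_def by blast
    show "\<exists>c\<ge>0. \<forall>s\<in>I. \<forall>t\<in>I. s \<noteq> t \<longrightarrow> \<bar>Zt (s, t) \<mu>\<bar> \<le> c * \<bar>t - s\<bar> powr (real (length \<mu>) / p)"
      unfolding a_def[symmetric]
    proof (intro exI[of _ "k ^ length \<mu> + K * diameter I powr (z - a)"] conjI ballI impI)
      show "0 \<le> k ^ length \<mu> + K * diameter I powr (z - a)" using k K by simp
    next
      fix s t assume I: "s \<in> I" "t \<in> I" and ne: "s \<noteq> t"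
      have "\<bar>Z (s, t) \<mu>\<bar> \<le> k ^ length \<mu> * \<bar>t - s\<bar> powr a"
        using Zk[OF sub[OF \<mu>]] k I ne by (simp add: hoelder_norm_le_iff component_def a_def)
      moreover have "K * \<bar>t - s\<bar> powr z \<le> K * (diameter I powr (z - a) * \<bar>t - s\<bar> powr a)"
        using K a L[OF I] by (intro mult_left_mono powr_le_powr_bounded) auto
      moreover note WK[OF \<mu> I] Zt[OF \<mu> I]
      ultimately show "\<bar>Zt (s, t) \<mu>\<bar> \<le> (k ^ length \<mu> + K * diameter I powr (z - a)) * \<bar>t - s\<bar> powr a"
        unfolding distrib_right mult.assoc by linarith
    qed
  qed
  have close: "\<exists>z>1. \<exists>K>0. \<forall>\<mu>\<in>multi_indices B N.
      hoelder_norm I z (\<lambda>x. component Z \<mu> x - component Zt \<mu> x) \<le> ennreal K"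
  proof (intro exI conjI ballI)
    fix \<mu> assume \<mu>: "\<mu> \<in> multi_indices B N"
    have "\<bar>Z (s, t) \<mu> - Zt (s, t) \<mu>\<bar> \<le> (K + 1) * \<bar>t - s\<bar> powr z" if I: "s \<in> I" "t \<in> I" for s t
      using WK[OF \<mu> I] Zt[OF \<mu> I] powr_ge_zero[of "\<bar>t - s\<bar>" z] unfolding distrib_right mult_1_left by linarith
    with K show "hoelder_norm I z (\<lambda>x. component Z \<mu> x - component Zt \<mu> x) \<le> ennreal (K + 1)"
      by (intro iffD2[OF hoelder_norm_le_iff]) (auto simp: component_def)
  next
    show "1 < z" "0 < K + 1" using z K by auto
  qed
  have unique: "Y = Zt" if Y: "multiplicative_path I B N Y"
    "\<exists>z>1. \<exists>K>0. \<forall>\<mu>\<in>multi_indices B N.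
      hoelder_norm I z (\<lambda>x. component Z \<mu> x - component Y \<mu> x) \<le> ennreal K" for Y
  proof -
    obtain z' K' where z': "1 < z'" and K': "0 < K'" and YK: "\<And>\<mu>. \<mu> \<in> multi_indices B N \<Longrightarrow>
        hoelder_norm I z' (\<lambda>x. component Z \<mu> x - component Y \<mu> x) \<le> ennreal K'"
      using Y(2) by blast
    show ?thesis
    proof (rule multiplicative_path_eqI[OF assms(4) Y(1) mult z z'])
      fix \<mu> s t assume \<mu>: "\<mu> \<in> multi_indices B N" and I: "s \<in> I" "t \<in> I" and ne: "s \<noteq> t"
      have "\<bar>Z (s, t) \<mu> - Y (s, t) \<mu>\<bar> \<le> K' * \<bar>t - s\<bar> powr z'"
        using YK[OF \<mu>] K' I ne by (simp add: hoelder_norm_le_iff component_def)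
      then show "\<bar>Y (s, t) \<mu> - Zt (s, t) \<mu>\<bar> \<le> K * \<bar>t - s\<bar> powr z + K' * \<bar>t - s\<bar> powr z'"
        using WK[OF \<mu> I] Zt[OF \<mu> I] by linarith
    qed
  qed
  show ?thesis
    unfolding N_def[symmetric]
  proof (rule ex1I[of _ Zt])
    show "multiplicative_path I B N Zt \<and> finite_p_variation I B p N Zt \<and>
      (\<exists>z>1. \<exists>K>0. \<forall>\<mu>\<in>multi_indices B N.
         hoelder_norm I z (\<lambda>x. component Z \<mu> x - component Zt \<mu> x) \<le> ennreal K)"
      using mult var close by blast
  qed (use unique in blast)
qed

end
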